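(* Suppose that $AT>1$ and $\rho>\xi(1-\sigma)$. Define $v:\mathcal O\to\mathbb R$ by $$v(x)=\nu\,\frac{[\Gamma_0(x)]^{1-\sigma}}{1-\sigma},\qquad \nu=\left(\frac{\rho-\xi(1-\sigma)}{\sigma}\right)^{-\sigma}\left(\frac A\xi\right)^{1-\sigma}.$$ Then $v$ is a classical solution on the open set $\mathcal O$ of the HJB equation $$\rho v(x)=\langle\mathcal A Dv(x),x\rangle+\sup_{i\in[0,Ax^0]}\left\{\frac{(Ax^0-i)^{1-\sigma}}{1-\sigma}+i\,B(Dv(x))\right\}.$$
   Context: $A>0$, $T>0$, $\rho>0$, $\sigma>0$ with $\sigma\ne1$ are real constants. When $AT>1$, $\xi$ denotes the unique strictly positive root of $z=A(1-e^{-zT})$. $X=\mathbb R\times L^2(-T,0;\mathbb R)$ with elements $x=(x^0,x^1)$ and inner product $\langle x,z\rangle=x^0z^0+\langle x^1,z^1\rangle_{L^2}$. The operator $\mathcal A$ on $X$ is $D(\mathcal A)=\{(\psi^0,\psi^1)\in X:\psi^1\in W^{1,2}(-T,0;\mathbb R),\ \psi^0=\psi^1(0)\}$, $\mathcal A(\psi^0,\psi^1)=(0,\frac{d}{ds}\psi^1)$, and $B:D(\mathcal A)\to\mathbb R$ is $B(\psi^0,\psi^1)=\psi^1(0)-\psi^1(-T)$. (The underlying state equation is $y'=\mathcal A^*y+B^*i$, so the HJB equation is the rigorous form of $\rho v(x)=\sup_{i\in[0,Ax^0]}\{\frac{(Ax^0-i)^{1-\sigma}}{1-\sigma}+\langle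 Dv(x),\mathcal A^*x+B^*i\rangle\}$.) $\Gamma_0(x)=x^0+\int_{-T}^0e^{\xi s}x^1(s)\,ds$ and $$\mathcal O=\left\{x\in X:\ \Gamma_0(x)>0\ \text{ and }\ Ax^0>\nu^{-1/\sigma}\left(\tfrac A\xi\right)^{1/\sigma}\Gamma_0(x)\right\}.$$ Classical solution on $\mathcal O$: $v\in C^1(\mathcal O)$ with $Dv\in C(\mathcal O;D(\mathcal A))$ ($D(\mathcal A)$ with the graph norm), satisfying the equation at every $x\in\mathcal O$. For $\sigma>1$ the expression $0^{1-\sigma}/(1-\sigma)$ is $-\infty$. *)

theory Defs
  imports "HOL-Analysis.Analysis"
begin

section \<open>The Hilbert space of square integrable functions\<close>

definition square_integrable :: "(real \<Rightarrow> real) \<Rightarrow> bool" where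
  "square_integrable f \<longleftrightarrow> f \<in> borel_measurable lborel \<and> integrable lborel (\<lambda>s. (f s)\<^sup>2)"

definition l2_eq :: "(real \<Rightarrow> real) \<Rightarrow> (real \<Rightarrow> real) \<Rightarrow> bool" where
  "l2_eq f g \<longleftrightarrow> square_integrable f \<and> square_integrable g \<and> (AE s in lborel. f s = g s)"

lemma square_integrable_0: "square_integrable (\<lambda>_. 0)"
  by (simp add: square_integrable_def)

lemma square_integrable_mult:
  assumes "square_integrable f" "square_integrable g"
  shows "integrable lborel (\<lambda>s. f s * g s)"
proof (rule Bochner_Integration.integrable_bound)
  show "integrable lborel (\<lambda>s. (f s)\<^sup>2 + (g s)\<^sup>2)"
    using assms by (simp add: square_integrable_def)
  show "(\<lambda>s. f s * g s) \<in> borel_measurable lborel"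
    using assms by (auto simp: square_integrable_def)
  have "\<bar>a * b\<bar> \<le> a\<^sup>2 + b\<^sup>2" for a b :: real
  proof -
    have "0 \<le> (\<bar>a\<bar> - \<bar>b\<bar>)\<^sup>2" by simp
    then have "2 * \<bar>a * b\<bar> \<le> a\<^sup>2 + b\<^sup>2"
      by (simp add: power2_diff abs_mult)
    then show ?thesis by linarith
  qed
  then show "AE s in lborel. norm (f s * g s) \<le> norm ((f s)\<^sup>2 + (g s)\<^sup>2)"
    by (simp add: abs_of_nonneg)
qed

lemma square_integrable_add:
  assumes "square_integrable f" "square_integrable g"
  shows "square_integrable (\<lambda>s. f s + g s)"
proof -
  have "integrable lborel (\<lambda>s. ((f s)\<^sup>2 + (g s)\<^sup>2) + 2 * (f s * g s))"
    using assms square_integrable_mult[OF assms]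
    by (intro Bochner_Integration.integrable_add integrable_mult_right)
       (auto simp: square_integrable_def)
  then show ?thesis
    using assms by (auto simp: square_integrable_def power2_sum mult.assoc)
qed

lemma square_integrable_scale:
  assumes "square_integrable f"
  shows "square_integrable (\<lambda>s. c * f s)"
  using assms by (auto simp: square_integrable_def power_mult_distrib)

lemma square_integrable_uminus:
  assumes "square_integrable f"
  shows "square_integrable (\<lambda>s. - f s)"
  using assms by (simp add: square_integrable_def)

lemma square_integrable_diff:
  assumes "square_integrable f" "square_integrable g"
  shows "square_integrable (\<lambda>s. f s - g s)"
  using square_integrable_add[OF assms(1) square_integrable_uminus[OF assms(2)]] by simp

lemma l2_eqI:
  "square_integrable f \<Longrightarrow> square_integrable g \<Longrightarrow> AE s in lborel. f s = g s \<Longrightarrow> l2_eq f g"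
  by (simp add: l2_eq_def)

lemma l2_eqD:
  assumes "l2_eq f g"
  shows "square_integrable f" "square_integrable g" "AE s in lborel. f s = g s"
  using assms by (simp_all add: l2_eq_def)

quotient_type l2 = "real \<Rightarrow> real" / partial: l2_eq
proof (rule part_equivpI)
  show "\<exists>f. l2_eq f f"
    using square_integrable_0 by (auto simp: l2_eq_def)
  show "symp l2_eq"
    unfolding symp_def l2_eq_def by (simp add: eq_commute)
  show "transp l2_eq"
  proof (rule transpI)
    fix f g h assume *: "l2_eq f g" "l2_eq g h"
    show "l2_eq f h"
    proof (rule l2_eqI)
      show "square_integrable f" "square_integrable h"
        using * by (blast dest: l2_eqD)+
      show "AE s in lborel. f s = h s"
        using l2_eqD(3)[OF *(1)] l2_eqD(3)[OF *(2)] by eventually_elim simp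
    qed
  qed
qed

instantiation l2 :: real_inner
begin

lift_definition zero_l2 :: l2 is "\<lambda>_. 0"
  by (simp add: l2_eq_def square_integrable_0)

lift_definition plus_l2 :: "l2 \<Rightarrow> l2 \<Rightarrow> l2" is "\<lambda>f g s. f s + g s"
proof (rule l2_eqI)
  fix f f' g g' :: "real \<Rightarrow> real"
  assume *: "l2_eq f f'" "l2_eq g g'"
  show "square_integrable (\<lambda>s. f s + g s)" "square_integrable (\<lambda>s. f' s + g' s)"
    using * by (blast intro: square_integrable_add dest: l2_eqD)+
  show "AE s in lborel. f s + g s = f' s + g' s"
    using l2_eqD(3)[OF *(1)] l2_eqD(3)[OF *(2)] by eventually_elim simp
qed

lift_definition minus_l2 :: "l2 \<Rightarrow> l2 \<Rightarrow> l2" is "\<lambda>f g s. f s - g s"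
proof (rule l2_eqI)
  fix f f' g g' :: "real \<Rightarrow> real"
  assume *: "l2_eq f f'" "l2_eq g g'"
  show "square_integrable (\<lambda>s. f s - g s)" "square_integrable (\<lambda>s. f' s - g' s)"
    using * by (blast intro: square_integrable_diff dest: l2_eqD)+
  show "AE s in lborel. f s - g s = f' s - g' s"
    using l2_eqD(3)[OF *(1)] l2_eqD(3)[OF *(2)] by eventually_elim simp
qed

lift_definition uminus_l2 :: "l2 \<Rightarrow> l2" is "\<lambda>f s. - f s"
proof (rule l2_eqI)
  fix f f' :: "real \<Rightarrow> real"
  assume *: "l2_eq f f'"
  show "square_integrable (\<lambda>s. - f s)" "square_integrable (\<lambda>s. - f' s)"
    using * by (blast intro: square_integrable_uminus dest: l2_eqD)+
  show "AE s in lborel. - f s = - f' s"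
    using l2_eqD(3)[OF *] by eventually_elim simp
qed

lift_definition scaleR_l2 :: "real \<Rightarrow> l2 \<Rightarrow> l2" is "\<lambda>c f s. c * f s"
proof (rule l2_eqI)
  fix f f' :: "real \<Rightarrow> real" and c :: real
  assume *: "l2_eq f f'"
  show "square_integrable (\<lambda>s. c * f s)" "square_integrable (\<lambda>s. c * f' s)"
    using * by (blast intro: square_integrable_scale dest: l2_eqD)+
  show "AE s in lborel. c * f s = c * f' s"
    using l2_eqD(3)[OF *] by eventually_elim simp
qed

lift_definition inner_l2 :: "l2 \<Rightarrow> l2 \<Rightarrow> real" is "\<lambda>f g. \<integral>s. f s * g s \<partial>lborel"
proof (rule integral_cong_AE)
  fix f f' g g' :: "real \<Rightarrow> real"
  assume *: "l2_eq f f'" "l2_eq g g'"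
  show "(\<lambda>s. f s * g s) \<in> borel_measurable lborel" "(\<lambda>s. f' s * g' s) \<in> borel_measurable lborel"
    using * by (blast intro: borel_measurable_integrable square_integrable_mult dest: l2_eqD)+
  show "AE s in lborel. f s * g s = f' s * g' s"
    using l2_eqD(3)[OF *(1)] l2_eqD(3)[OF *(2)] by eventually_elim simp
qed

definition norm_l2 :: "l2 \<Rightarrow> real" where "norm_l2 f = sqrt (inner f f)"

definition dist_l2 :: "l2 \<Rightarrow> l2 \<Rightarrow> real" where "dist_l2 f g = norm (f - g)"

definition sgn_l2 :: "l2 \<Rightarrow> l2" where "sgn_l2 f = inverse (norm f) *\<^sub>R f"

definition uniformity_l2 :: "(l2 \<times> l2) filter" where
  "uniformity_l2 = (INF e\<in>{0<..}. principal {(x, y). dist x y < e})"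

definition open_l2 :: "l2 set \<Rightarrow> bool" where
  "open_l2 U \<longleftrightarrow> (\<forall>x\<in>U. eventually (\<lambda>(x', y). x' = x \<longrightarrow> y \<in> U) uniformity)"

instance
proof
  fix f g h :: l2 and a b :: real
  show "f + g + h = f + (g + h)"
    by transfer (simp add: l2_eq_def square_integrable_add add.assoc[symmetric])
  show "f + g = g + f"
    by transfer (simp add: l2_eq_def square_integrable_add add.commute)
  show "0 + f = f"
    by transfer (simp add: l2_eq_def)
  show "- f + f = 0"
    by transfer (simp add: l2_eq_def square_integrable_0)
  show "f - g = f + - g"
    by transfer (simp add: l2_eq_def square_integrable_diff)
  show "a *\<^sub>R (f + g) = a *\<^sub>R f + a *\<^sub>R g"
    by transfer (simp add: l2_eq_def square_integrable_add square_integrable_scale distrib_left[symmetric])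
  show "(a + b) *\<^sub>R f = a *\<^sub>R f + b *\<^sub>R f"
    by transfer (simp add: l2_eq_def square_integrable_scale distrib_right[symmetric])
  show "a *\<^sub>R b *\<^sub>R f = (a * b) *\<^sub>R f"
    by transfer (simp add: l2_eq_def square_integrable_scale mult.assoc[symmetric])
  show "1 *\<^sub>R f = f"
    by transfer (simp add: l2_eq_def)
  show "inner f g = inner g f"
    by transfer (simp add: mult.commute)
  show "inner (f + g) h = inner f h + inner g h"
    by transfer (simp add: l2_eq_def distrib_right square_integrable_mult)
  show "inner (a *\<^sub>R f) g = a * inner f g"
    by transfer (simp add: mult.assoc)
  show "0 \<le> inner f f"
    by transfer simp
  show "inner f f = 0 \<longleftrightarrow> f = 0"
  proof transfer
    fix f assume f: "l2_eq f f"
    have "(\<integral>s. f s * f s \<partial>lborel) = 0 \<longleftrightarrow> (AE s in lborel. f s * f s = 0)"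
      using square_integrable_mult[OF l2_eqD(1) l2_eqD(1), OF f f]
      by (intro integral_nonneg_eq_0_iff_AE) simp_all
    then show "(\<integral>s. f s * f s \<partial>lborel) = 0 \<longleftrightarrow> l2_eq f (\<lambda>_. 0)"
      using f by (simp add: l2_eq_def square_integrable_0)
  qed
  show "norm f = sqrt (inner f f)"
    by (fact norm_l2_def)
  show "dist f g = norm (f - g)"
    by (fact dist_l2_def)
  show "sgn f = inverse (norm f) *\<^sub>R f"
    by (fact sgn_l2_def)
  show "(uniformity :: (l2 \<times> l2) filter) = (INF e\<in>{0<..}. principal {(x, y). dist x y < e})"
    by (fact uniformity_l2_def)
  show "open U \<longleftrightarrow> (\<forall>x\<in>U. eventually (\<lambda>(x', y). x' = x \<longrightarrow> y \<in> U) uniformity)" for U :: "l2 set"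
    by (fact open_l2_def)
qed

end

section \<open>The state space and its operators\<close>

text \<open>\<open>rep_l2 f\<close> is an arbitrarily chosen representative of the class \<open>f\<close>; it is only used below
  in ways that do not depend on this choice.\<close>

text \<open>An element of $L^2(-T,0)$ is identified with its extension by zero to the real line.
  With the inner product of the product type \<open>real \<times> l2\<close>, this makes the state space
  a subspace of \<open>real \<times> l2\<close>.\<close>

definition L2_on :: "real \<Rightarrow> l2 set" where
  "L2_on T = {f. AE s in lborel. s \<notin> {-T<..<0} \<longrightarrow> rep_l2 f s = 0}"

definition state_space :: "real \<Rightarrow> (real \<times> l2) set" where
  "state_space T = UNIV \<times> L2_on T"

text \<open>As in Brezis, test functions are only required to be of class $C^1$; smooth ones yield the
  same weak derivatives.\<close>

definition test_function :: "real \<Rightarrow> (real \<Rightarrow> real) \<Rightarrow> bool" where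
  "test_function T \<phi> \<longleftrightarrow>
     (\<forall>s. \<phi> differentiable (at s)) \<and> continuous_on UNIV (deriv \<phi>) \<and>
     (\<exists>K. compact K \<and> K \<subseteq> {-T<..<0} \<and> (\<forall>s. s \<notin> K \<longrightarrow> \<phi> s = 0))"

definition weak_derivative :: "real \<Rightarrow> l2 \<Rightarrow> l2 \<Rightarrow> bool" where
  "weak_derivative T f g \<longleftrightarrow>
     (\<forall>\<phi>. test_function T \<phi> \<longrightarrow>
        (LINT s:{-T<..<0}|lborel. rep_l2 f s * deriv \<phi> s) =
        - (LINT s:{-T<..<0}|lborel. rep_l2 g s * \<phi> s))"

definition W12 :: "real \<Rightarrow> l2 set" where
  "W12 T = {f \<in> L2_on T. \<exists>g \<in> L2_on T. weak_derivative T f g}"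

definition wderiv :: "real \<Rightarrow> l2 \<Rightarrow> l2" where
  "wderiv T f = (THE g. g \<in> L2_on T \<and> weak_derivative T f g)"

text \<open>The value at $s \in [-T,0]$ of the continuous representative on $[-T,0]$.\<close>

definition point_value :: "real \<Rightarrow> l2 \<Rightarrow> real \<Rightarrow> real" where
  "point_value T f s =
     (THE y. \<exists>u. continuous_on {-T..0} u \<and>
        (AE r in lborel. r \<in> {-T<..<0} \<longrightarrow> rep_l2 f r = u r) \<and> y = u s)"

definition dom_A :: "real \<Rightarrow> (real \<times> l2) set" where
  "dom_A T = {\<psi>. snd \<psi> \<in> W12 T \<and> fst \<psi> = point_value T (snd \<psi>) 0}"

definition op_A :: "real \<Rightarrow> real \<times> l2 \<Rightarrow> real \<times> l2" where
  "op_A T \<psi> = (0, wderiv T (snd \<psi>))"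

definition op_B :: "real \<Rightarrow> real \<times> l2 \<Rightarrow> real" where
  "op_B T \<psi> = point_value T (snd \<psi>) 0 - point_value T (snd \<psi>) (- T)"

definition graph_norm :: "real \<Rightarrow> real \<times> l2 \<Rightarrow> real" where
  "graph_norm T \<psi> = sqrt ((norm \<psi>)\<^sup>2 + (norm (op_A T \<psi>))\<^sup>2)"

section \<open>The HJB equation\<close>

definition utility :: "real \<Rightarrow> real \<Rightarrow> ereal" where
  "utility \<sigma> c = (if c = 0 \<and> \<sigma> > 1 then -\<infinity> else ereal (c powr (1 - \<sigma>) / (1 - \<sigma>)))"

text \<open>As \<open>U\<close> is open in the state space, the gradient \<open>Dv x\<close>, being an element of the state space,
  is determined by the derivative of \<open>v\<close> at \<open>x\<close> within \<open>U\<close>.\<close>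

definition classical_solution ::
  "real \<Rightarrow> real \<Rightarrow> real \<Rightarrow> real \<Rightarrow> (real \<times> l2) set \<Rightarrow> (real \<times> l2 \<Rightarrow> real) \<Rightarrow> bool" where
  "classical_solution A T \<rho> \<sigma> U v \<longleftrightarrow>
     openin (top_of_set (state_space T)) U \<and>
     (\<exists>Dv :: real \<times> l2 \<Rightarrow> real \<times> l2.
        (\<forall>x\<in>U. Dv x \<in> state_space T \<and> (v has_derivative (\<lambda>h. inner (Dv x) h)) (at x within U)) \<and>
        continuous_on U Dv \<and>
        (\<forall>x\<in>U. Dv x \<in> dom_A T) \<and>
        (\<forall>x\<in>U. ((\<lambda>y. graph_norm T (Dv y - Dv x)) \<longlongrightarrow> 0) (at x within U)) \<and>
        (\<forall>x\<in>U. ereal (\<rho> * v x) =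
           ereal (inner (op_A T (Dv x)) x) +
           (SUP i\<in>{0..A * fst x}. utility \<sigma> (A * fst x - i) + ereal (i * op_B T (Dv x)))))"

section \<open>The explicit solution\<close>

definition xi :: "real \<Rightarrow> real \<Rightarrow> real" where
  "xi A T = (THE z. z > 0 \<and> z = A * (1 - exp (- z * T)))"

definition Gamma0 :: "real \<Rightarrow> real \<Rightarrow> real \<times> l2 \<Rightarrow> real" where
  "Gamma0 A T x = fst x + (LINT s:{-T<..<0}|lborel. exp (xi A T * s) * rep_l2 (snd x) s)"

definition nu :: "real \<Rightarrow> real \<Rightarrow> real \<Rightarrow> real \<Rightarrow> real" where
  "nu A T \<rho> \<sigma> =
     ((\<rho> - xi A T * (1 - \<sigma>)) / \<sigma>) powr (- \<sigma>) * (A / xi A T) powr (1 - \<sigma>)"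

definition domain_O :: "real \<Rightarrow> real \<Rightarrow> real \<Rightarrow> real \<Rightarrow> (real \<times> l2) set" where
  "domain_O A T \<rho> \<sigma> =
     {x \<in> state_space T. Gamma0 A T x > 0 \<and>
        A * fst x > nu A T \<rho> \<sigma> powr (- 1 / \<sigma>) * (A / xi A T) powr (1 / \<sigma>) * Gamma0 A T x}"

definition value_v :: "real \<Rightarrow> real \<Rightarrow> real \<Rightarrow> real \<Rightarrow> real \<times> l2 \<Rightarrow> real" where
  "value_v A T \<rho> \<sigma> x = nu A T \<rho> \<sigma> * (Gamma0 A T x powr (1 - \<sigma>) / (1 - \<sigma>))"

end

theory Submission
  imports Defs
begin

text \<open>By \<open>Gamma0_eq_inner\<close>, $\Gamma_0(x) = \langle e, x\rangle$ with $e = (1, e^{\xi\cdot})$. Hence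
  $Dv(x) = p\,e$ with $p = \nu\,\Gamma_0(x)^{-\sigma}$; moreover $\mathcal A e = (0, \xi e^{\xi\cdot})$
  and, by the equation for $\xi$, $B(e) = 1 - e^{-\xi T} = \xi/A$. By concavity of the utility, the
  supremum is attained where the consumption $c = Ax^0 - i$ satisfies $c^{-\sigma} = p\,\xi/A$,
  that is $c = M (A/\xi)\Gamma_0(x)$ with $M = (\rho - \xi(1-\sigma))/\sigma$; the second condition
  in the definition of $\mathcal O$ says exactly that this $c$ is admissible. What remains is algebra.

  That weak derivatives are unique is the fundamental lemma of the calculus of variations: explicit
  $C^1$ bumps converge boundedly to indicators of intervals, and Lebesgue differentiation
  concludes.\<close>

section \<open>Representatives of square integrable classes\<close>

lemma l2_eq_rep_l2: "l2_eq (rep_l2 f) (rep_l2 f)"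
  using Quotient3_l2 Quotient3_rep_reflp by fastforce

lemma square_integrable_rep_l2: "square_integrable (rep_l2 f)"
  using l2_eq_rep_l2 by (rule l2_eqD)

lemma rep_l2_measurable [measurable]: "rep_l2 f \<in> borel_measurable borel"
  using square_integrable_rep_l2[of f] by (simp add: square_integrable_def)

lemma abs_rep_l2: "abs_l2 (rep_l2 f) = f"
  by (rule Quotient3_abs_rep[OF Quotient3_l2])

text \<open>\<open>rep_l2\<close> chooses an arbitrary representative, so a function is recovered
  from its class only almost everywhere.\<close>

lemma rep_abs_l2:
  assumes "square_integrable f"
  shows "AE s in lborel. rep_l2 (abs_l2 f) s = f s"
proof -
  have "l2_eq f f"
    using assms by (simp add: l2_eq_def)
  then have "l2_eq (rep_l2 (abs_l2 f)) f"
    by (rule Quotient3_rep_abs[OF Quotient3_l2])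
  then show ?thesis
    by (rule l2_eqD)
qed

lemma l2_eqI_AE:
  assumes "AE s in lborel. rep_l2 f s = rep_l2 g s"
  shows "f = g"
proof -
  have "l2_eq (rep_l2 f) (rep_l2 g)"
    using assms by (intro l2_eqI square_integrable_rep_l2)
  then show ?thesis
    using Quotient3_rel_rep[OF Quotient3_l2] by blast
qed

lemma inner_l2_rep: "inner f g = (\<integral>s. rep_l2 f s * rep_l2 g s \<partial>lborel)"
  using inner_l2.abs_eq[OF l2_eq_rep_l2 l2_eq_rep_l2, of f g] by (simp add: abs_rep_l2)

lemma rep_scaleR_l2: "AE s in lborel. rep_l2 (c *\<^sub>R f) s = c * rep_l2 f s"
proof -
  have "c *\<^sub>R f = abs_l2 (\<lambda>s. c * rep_l2 f s)"
    using scaleR_l2.abs_eq[OF l2_eq_rep_l2, of c f] by (simp add: abs_rep_l2)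
  then show ?thesis
    by (simp add: rep_abs_l2 square_integrable_scale square_integrable_rep_l2)
qed

section \<open>The fundamental lemma of the calculus of variations\<close>

text \<open>For \<open>a \<le> b\<close> a \<open>C\<^sup>1\<close> function, positive exactly on \<open>{a<..<b}\<close> if \<open>n > 0\<close>, as
  \<open>t \<mapsto> (max 0 t)\<^sup>2\<close> is \<open>C\<^sup>1\<close> and \<open>(s - a) * (b - s)\<close> is positive exactly there.\<close>

definition bump :: "real \<Rightarrow> real \<Rightarrow> nat \<Rightarrow> real \<Rightarrow> real" where
  "bump a b n s = (let w = real n * (max 0 ((s - a) * (b - s)))\<^sup>2 in w / (1 + w))"

lemma bump_nonneg: "0 \<le> bump a b n s"
  by (simp add: bump_def Let_def)

lemma bump_le_1: "bump a b n s \<le> 1"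
  by (simp add: bump_def Let_def divide_le_eq_1 add_pos_nonneg)

lemma bump_measurable [measurable]: "bump a b n \<in> borel_measurable borel"
  unfolding bump_def Let_def by measurable

lemma bump_eq_0:
  assumes "a \<le> b" "s \<notin> {a..b}"
  shows "bump a b n s = 0"
proof -
  have "(s - a) * (b - s) \<le> 0"
    using assms by (auto simp: mult_le_0_iff)
  then show ?thesis
    by (simp add: bump_def)
qed

text \<open>Where the quadratic is positive, with square \<open>r\<close>, the bump equals
  \<open>1 - 1 / (1 + n * r)\<close> and tends to 1; elsewhere it is 0 for every
  \<open>n\<close>.\<close>

lemma bump_tendsto:
  assumes "a \<le> b"
  shows "(\<lambda>n. bump a b n s) \<longlonglongrightarrow> indicator {a<..<b} s"
proof (cases "(s - a) * (b - s) > 0")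
  case True
  define r where "r = ((s - a) * (b - s))\<^sup>2"
  have "r > 0"
    unfolding r_def using True by (rule zero_less_power)
  then have "(\<lambda>n. 1 - inverse (1 + real n * r)) \<longlonglongrightarrow> 1 - 0"
    by (intro tendsto_diff tendsto_const tendsto_inverse_0_at_top
        filterlim_tendsto_add_at_top[OF tendsto_const]
        filterlim_at_top_mult_tendsto_pos[OF tendsto_const] filterlim_real_sequentially)
  moreover have "1 - inverse (1 + real n * r) = bump a b n s" for n
  proof -
    have "1 + real n * r > 0"
      using \<open>r > 0\<close> by (simp add: add_pos_nonneg)
    then have "1 - inverse (1 + real n * r) = real n * r / (1 + real n * r)"
      by (simp add: field_simps)
    then show ?thesis
      using True by (simp add: bump_def r_def Let_def)
  qed
  \<comment> \<open>If both factors were negative, then \<open>b < s < a\<close>, contrary to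
    \<open>a \<le> b\<close>.\<close>
  moreover have "s \<in> {a<..<b}"
    using True assms by (auto simp: zero_less_mult_iff)
  ultimately show ?thesis
    by simp
next
  case False
  then have "s \<notin> {a<..<b}"
    by (auto simp: not_less mult_le_0_iff)
  then show ?thesis
    using False by (simp add: bump_def max_absorb1 not_less)
qed

text \<open>Off the origin the function agrees locally with 0 or with the square of
  \<open>t\<close>; at the origin the difference quotient is squeezed between
  \<open>- \<bar>h\<bar>\<close> and \<open>\<bar>h\<bar>\<close>.\<close>

lemma has_real_derivative_max_0_square:
  "((\<lambda>t. (max 0 t)\<^sup>2) has_real_derivative 2 * max 0 t) (at (t::real))"
proof (cases t "0::real" rule: linorder_cases)
  case less
  have "((\<lambda>t. 0) has_real_derivative 2 * max 0 t) (at t)"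
    using less by (auto intro!: derivative_eq_intros)
  then show ?thesis
    by (rule DERIV_cong_ev[THEN iffD1, OF refl _ refl, rotated])
      (auto intro: eventually_mono[OF eventually_nhds_in_open[of "{..<0}"]] simp: less)
next
  case equal
  have "((\<lambda>h. (max 0 h)\<^sup>2 / h) \<longlongrightarrow> 0) (at (0::real))"
  proof (rule tendsto_sandwich[of "\<lambda>h. - \<bar>h\<bar>" _ _ "\<lambda>h. \<bar>h\<bar>"])
    show "\<forall>\<^sub>F h in at (0::real). - \<bar>h\<bar> \<le> (max 0 h)\<^sup>2 / h"
      by (auto simp: max_def power2_eq_square)
    show "\<forall>\<^sub>F h in at (0::real). (max 0 h)\<^sup>2 / h \<le> \<bar>h\<bar>"
      by (auto simp: max_def power2_eq_square)
    have "((\<lambda>h::real. \<bar>h\<bar>) \<longlongrightarrow> \<bar>0\<bar>) (at 0)"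
      by (intro tendsto_intros)
    then show "((\<lambda>h::real. \<bar>h\<bar>) \<longlongrightarrow> 0) (at 0)" by simp
    then show "((\<lambda>h::real. - \<bar>h\<bar>) \<longlongrightarrow> 0) (at 0)"
      using tendsto_minus by fastforce
  qed
  then show ?thesis
    by (simp add: equal DERIV_def)
next
  case greater
  have "((\<lambda>t. t\<^sup>2) has_real_derivative 2 * max 0 t) (at t)"
    using greater by (auto intro!: derivative_eq_intros)
  then show ?thesis
    by (rule DERIV_cong_ev[THEN iffD1, OF refl _ refl, rotated])
      (auto intro: eventually_mono[OF eventually_nhds_in_open[of "{0<..}"]] simp: greater)
qed

text \<open>The denominator \<open>1 + w\<close> never vanishes, so the quotient inherits the
  regularity of \<open>w\<close>. The strict bounds on \<open>a\<close> and \<open>b\<close> place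
  the compact set \<open>{a..b}\<close> inside the open interval.\<close>

lemma test_function_bump:
  assumes "-T < a" "a \<le> b" "b < 0"
  shows "test_function T (bump a b n)"
proof -
  define q where "q = (\<lambda>s::real. (s - a) * (b - s))"
  define w where "w = (\<lambda>s. real n * (max 0 (q s))\<^sup>2)"
  define w' where "w' = (\<lambda>s. real n * (2 * max 0 (q s) * (b - s - (s - a))))"
  have w_pos: "1 + w s > 0" for s
    by (simp add: w_def add_pos_nonneg)
  have q: "(q has_real_derivative (b - s - (s - a))) (at s)" for s
    unfolding q_def by (auto intro!: derivative_eq_intros)
  have "((\<lambda>s. (max 0 (q s))\<^sup>2) has_real_derivative 2 * max 0 (q s) * (b - s - (s - a))) (at s)" for s
    using DERIV_chain2[OF has_real_derivative_max_0_square q] .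
  then have w: "(w has_real_derivative w' s) (at s)" for s
    unfolding w_def w'_def by (rule DERIV_cmult)
  have bump: "bump a b n = (\<lambda>s. w s / (1 + w s))"
    by (simp add: bump_def w_def q_def Let_def fun_eq_iff)
  have d: "(bump a b n has_real_derivative w' s / (1 + w s)\<^sup>2) (at s)" for s
    unfolding bump using w_pos[of s]
    by (auto intro!: derivative_eq_intros w simp: field_simps power2_eq_square)
  have "continuous_on UNIV w'" "continuous_on UNIV w"
    unfolding w_def w'_def q_def by (intro continuous_intros)+
  then have "continuous_on UNIV (\<lambda>s. w' s / (1 + w s)\<^sup>2)"
    using w_pos by (intro continuous_intros) (auto simp: less_le)
  moreover have "deriv (bump a b n) = (\<lambda>s. w' s / (1 + w s)\<^sup>2)"
    using d by (auto intro: DERIV_imp_deriv)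
  moreover have "bump a b n differentiable (at s)" for s
    using d real_differentiable_def by blast
  moreover have "compact {a..b}" "{a..b} \<subseteq> {-T<..<0}"
    using assms by auto
  ultimately show ?thesis
    unfolding test_function_def using bump_eq_0[OF assms(2)] by (metis (no_types))
qed

text \<open>By Lebesgue differentiation, \<open>f x\<close> is for almost every \<open>x\<close> the
  limit of the averages of \<open>f\<close> over \<open>{x..x + h}\<close>, and these vanish for
  small \<open>h\<close>.\<close>

lemma AE_eq_0_if_interval_integrals_eq_0:
  fixes f :: "real \<Rightarrow> real"
  assumes f: "integrable lborel f"
    and zero: "\<And>a b. a < b \<Longrightarrow> {a..b} \<subseteq> {c<..<d} \<Longrightarrow> (LINT s:{a<..<b}|lborel. f s) = 0"
  shows "AE s in lborel. s \<in> {c<..<d} \<longrightarrow> f s = 0"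
proof -
  have int: "set_integrable lborel S f" if "S \<in> sets lborel" for S
    using f that unfolding set_integrable_def by (rule integrable_mult_indicator[rotated])
  have "f integrable_on cbox a b" for a b
    using int[of "{a..b}"] by (simp add: set_borel_integral_eq_integral)
  then obtain N where N: "negligible N"
    "\<And>x e. \<lbrakk>x \<notin> N; 0 < e\<rbrakk> \<Longrightarrow> \<exists>d>0. \<forall>h. 0 < h \<and> h < d \<longrightarrow>
       norm (integral (cbox x (x + h *\<^sub>R One)) f /\<^sub>R h ^ DIM(real) - f x) < e"
    using integrable_ccontinuous_explicit[of f] by blast
  have "f x = 0" if x: "x \<in> {c<..<d}" "x \<notin> N" for x
  proof (rule ccontr)
    assume "f x \<noteq> 0"
    then obtain r where r: "r > 0" "\<And>h. 0 < h \<Longrightarrow> h < r \<Longrightarrow> norm (integral {x..x + h} f /\<^sub>R h - f x) < \<bar>f x\<bar>"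
      using N(2)[OF x(2), of "\<bar>f x\<bar>"] by auto
    \<comment> \<open>Below \<open>r\<close>, so that the average differs from \<open>f x\<close> by
      less than \<open>\<bar>f x\<bar>\<close>; below \<open>d - x\<close>, so that the interval
      stays in the range where the average is 0. The two facts are incompatible.\<close>
    define h where "h = min r (d - x) / 2"
    have h: "0 < h" "h < r" "x + h < d"
      using r x by (auto simp: h_def min_def field_simps)
    have "integral {x..x + h} f = integral {x<..<x + h} f"
      by (simp add: integral_open_interval_real)
    also have "\<dots> = (LINT s:{x<..<x + h}|lborel. f s)"
      using int[of "{x<..<x + h}"] by (simp add: set_borel_integral_eq_integral)
    also have "\<dots> = 0"
      using h x by (intro zero) auto
    finally show False
      using r(2)[of h] h by simp
  qed
  moreover have "AE x in lborel. x \<notin> N"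
  proof -
    have "N \<in> null_sets lebesgue"
      using N(1) by (simp add: negligible_iff_null_sets)
    then have "AE x in lebesgue. x \<notin> N"
      by (rule AE_not_in)
    then show ?thesis
      by (simp add: AE_completion_iff)
  qed
  ultimately show ?thesis
    by (auto elim: eventually_mono)
qed

text \<open>Testing with bumps and passing to the limit shows that the integrals over subintervals
  vanish. The extension by zero \<open>F\<close> is integrable on the whole line and
  \<open>\<bar>F\<bar>\<close> dominates all products, since the bumps lie between 0 and 1.\<close>

lemma AE_eq_0_if_test_integrals_eq_0:
  fixes f :: "real \<Rightarrow> real"
  assumes f: "set_integrable lborel {-T<..<0} f" 
    and zero: "\<And>\<phi>. test_function T \<phi> \<Longrightarrow> (LINT s:{-T<..<0}|lborel. f s * \<phi> s) = 0"
  shows "AE s in lborel. s \<in> {-T<..<0} \<longrightarrow> f s = 0"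
proof -
  define F where "F = (\<lambda>s. indicator {-T<..<0} s * f s)"
  have F: "integrable lborel F"
    using f by (simp add: F_def set_integrable_def)
  note [measurable] = borel_measurable_integrable[OF F]
  have "AE s in lborel. s \<in> {-T<..<0} \<longrightarrow> F s = 0"
  proof (rule AE_eq_0_if_interval_integrals_eq_0[OF F])
    fix a b :: real assume ab: "a < b" "{a..b} \<subseteq> {-T<..<0}"
    then have *: "-T < a" "a \<le> b" "b < 0"
      using subsetD[OF ab(2), of a] subsetD[OF ab(2), of b] by auto
    have "(\<lambda>n. \<integral>s. F s * bump a b n s \<partial>lborel) \<longlonglongrightarrow> (\<integral>s. F s * indicator {a<..<b} s \<partial>lborel)"
    proof (rule integral_dominated_convergence[where w = "\<lambda>s. \<bar>F s\<bar>"])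
      show "AE s in lborel. (\<lambda>n. F s * bump a b n s) \<longlonglongrightarrow> F s * indicator {a<..<b} s"
        by (intro AE_I2 tendsto_intros bump_tendsto *)
      show "AE s in lborel. norm (F s * bump a b n s) \<le> \<bar>F s\<bar>" for n
        by (intro AE_I2) (simp add: abs_mult mult_left_le bump_nonneg bump_le_1)
    qed (use F in auto)
    moreover have "(\<integral>s. F s * bump a b n s \<partial>lborel) = 0" for n
      using zero[OF test_function_bump[OF *], of n]
      by (simp add: F_def set_lebesgue_integral_def mult_ac)
    ultimately show "(LINT s:{a<..<b}|lborel. F s) = 0"
      by (simp add: LIMSEQ_const_iff set_lebesgue_integral_def mult.commute)
  qed
  then show ?thesis
    by (simp add: F_def)
qed

lemma test_function_continuous: "test_function T \<phi> \<Longrightarrow> continuous_on S \<phi>"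
  unfolding test_function_def
  by (meson continuous_at_imp_continuous_on differentiable_imp_continuous_within)

lemma test_function_eq_0:
  assumes "test_function T \<phi>" "s \<notin> {-T<..<0}"
  shows "\<phi> s = 0"
  using assms unfolding test_function_def by blast

lemma square_integrable_indicator_mult:
  assumes "continuous_on {a..b} f"
  shows "square_integrable (\<lambda>s. indicator {a<..<b} s * f s)"
proof -
  have f: "set_integrable lborel {a<..<b} g" if "continuous_on {a..b} g" for g :: "real \<Rightarrow> real"
    by (rule set_integrable_subset[OF borel_integrable_atLeastAtMost'[OF that]]) auto
  have "integrable lborel (\<lambda>s. indicator {a<..<b} s *\<^sub>R (f s)\<^sup>2)"
    using f[of "\<lambda>s. (f s)\<^sup>2"] assms by (simp add: set_integrable_def continuous_on_power)
  moreover have "indicator {a<..<b} s *\<^sub>R (f s)\<^sup>2 = (indicator {a<..<b} s * f s)\<^sup>2" for s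
    by (simp add: power_mult_distrib indicator_def)
  moreover have "(\<lambda>s. indicator {a<..<b} s * f s) \<in> borel_measurable lborel"
    using borel_measurable_integrable[OF f[OF assms, unfolded set_integrable_def]] by simp
  ultimately show ?thesis
    by (simp add: square_integrable_def)
qed

lemma set_integrable_rep_l2_mult:
  assumes "continuous_on {a..b} \<phi>"
  shows "set_integrable lborel {a<..<b} (\<lambda>s. rep_l2 f s * \<phi> s)"
  using square_integrable_mult[OF square_integrable_rep_l2 square_integrable_indicator_mult[OF assms]]
  by (simp add: set_integrable_def mult_ac)

section \<open>Weak derivatives and point values\<close>

text \<open>As \<open>wderiv\<close> is a definite description, uniqueness has to be shown: the
  difference of two weak derivatives integrates to 0 against every test function, hence vanishes on
  the interval, while membership in \<open>L2_on T\<close> settles the outside.\<close>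

lemma wderiv_eqI:
  assumes g: "g \<in> L2_on T" "weak_derivative T f g"
  shows "wderiv T f = g"
  unfolding wderiv_def
proof (rule the_equality)
  fix h assume h: "h \<in> L2_on T \<and> weak_derivative T f h"
  define d where "d = (\<lambda>s. rep_l2 h s - rep_l2 g s)"
  have "AE s in lborel. s \<in> {-T<..<0} \<longrightarrow> d s = 0"
  proof (rule AE_eq_0_if_test_integrals_eq_0)
    show "set_integrable lborel {-T<..<0} d"
      using set_integrable_rep_l2_mult[of "-T" 0 "\<lambda>_. 1" h]
        set_integrable_rep_l2_mult[of "-T" 0 "\<lambda>_. 1" g]
      by (simp add: d_def set_integral_diff)
    fix \<phi> assume \<phi>: "test_function T \<phi>"
    have "(LINT s:{-T<..<0}|lborel. rep_l2 h s * \<phi> s) = (LINT s:{-T<..<0}|lborel. rep_l2 g s * \<phi> s)"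
      using g h \<phi> by (simp add: weak_derivative_def)
    moreover have "set_integrable lborel {-T<..<0} (\<lambda>s. rep_l2 f s * \<phi> s)" for f
      by (intro set_integrable_rep_l2_mult test_function_continuous[OF \<phi>])
    ultimately show "(LINT s:{-T<..<0}|lborel. d s * \<phi> s) = 0"
      by (simp add: d_def left_diff_distrib set_integral_diff)
  qed
  moreover have "AE s in lborel. s \<notin> {-T<..<0} \<longrightarrow> rep_l2 h s = 0"
    "AE s in lborel. s \<notin> {-T<..<0} \<longrightarrow> rep_l2 g s = 0"
    using g h by (simp_all add: L2_on_def)
  ultimately have "AE s in lborel. rep_l2 h s = rep_l2 g s"
    by eventually_elim (auto simp: d_def)
  then show "h = g"
    by (rule l2_eqI_AE)
qed (use g in simp)

text \<open>The points of the open interval where \<open>u\<close> and \<open>v\<close> differ form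
  an open null set, which must be empty; continuity carries the equality to the endpoints, where
  \<open>op_B\<close> evaluates.\<close>

lemma continuous_on_eq_if_AE_eq:
  fixes u v :: "real \<Rightarrow> real"
  assumes "a < b" "continuous_on {a..b} u" "continuous_on {a..b} v"
    and eq: "AE s in lborel. s \<in> {a<..<b} \<longrightarrow> u s = v s"
    and s: "s \<in> {a..b}"
  shows "u s = v s"
proof -
  define d where "d = (\<lambda>s. u s - v s)"
  have d: "continuous_on {a..b} d"
    unfolding d_def using assms by (intro continuous_intros)
  define S where "S = {s \<in> {a<..<b}. d s \<in> - {0}}"
  have "continuous_on {a<..<b} d"
    by (rule continuous_on_subset[OF d]) auto
  then have "open S"
    unfolding S_def
    by (intro continuous_open_preimage[unfolded vimage_def Int_def mem_Collect_eq]) auto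
  moreover have "AE s in lborel. s \<notin> S"
    using eq by eventually_elim (simp add: S_def d_def)
  then have "AE s in lebesgue. s \<notin> S"
    by (simp add: AE_completion_iff)
  then have "negligible S"
    using \<open>open S\<close> by (simp add: negligible_iff_null_sets AE_iff_null_sets)
  ultimately have "S = {}"
    using open_not_negligible by blast
  then have "d x = 0" if "x \<in> {a<..<b}" for x
    using that by (auto simp: S_def)
  moreover have "closure {a<..<b} = {a..b}"
    using assms by simp
  ultimately have "d s = 0"
    using continuous_constant_on_closure[of "{a<..<b}" d 0 s] d s by simp
  then show ?thesis
    by (simp add: d_def)
qed

lemma point_value_eqI:
  assumes "T > 0" "continuous_on {-T..0} u"
    and "AE r in lborel. r \<in> {-T<..<0} \<longrightarrow> rep_l2 f r = u r"
    and "s \<in> {-T..0}"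
  shows "point_value T f s = u s"
  unfolding point_value_def
proof (rule the_equality)
  fix y
  assume "\<exists>v. continuous_on {-T..0} v \<and>
    (AE r in lborel. r \<in> {-T<..<0} \<longrightarrow> rep_l2 f r = v r) \<and> y = v s"
  then obtain v where v: "continuous_on {-T..0} v" "y = v s"
    "AE r in lborel. r \<in> {-T<..<0} \<longrightarrow> rep_l2 f r = v r"
    by blast
  have "AE r in lborel. r \<in> {-T<..<0} \<longrightarrow> v r = u r"
    using v(3) assms(3) by eventually_elim simp
  then show "y = u s"
    using continuous_on_eq_if_AE_eq[of "-T" 0 v u s] v assms by simp
qed (use assms in blast)

section \<open>Exponentials as elements of the state space\<close>

definition exp_l2 :: "real \<Rightarrow> real \<Rightarrow> l2" where
  "exp_l2 T a = abs_l2 (\<lambda>s. indicator {-T<..<0} s * exp (a * s))"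

lemma rep_exp_l2: "AE s in lborel. rep_l2 (exp_l2 T a) s = indicator {-T<..<0} s * exp (a * s)"
  unfolding exp_l2_def
  by (intro rep_abs_l2 square_integrable_indicator_mult continuous_intros)

lemma rep_scaleR_exp_l2:
  "AE s in lborel. rep_l2 (c *\<^sub>R exp_l2 T a) s = indicator {-T<..<0} s * (c * exp (a * s))"
  using rep_scaleR_l2[of c "exp_l2 T a"] rep_exp_l2[of T a]
  by eventually_elim simp

lemma scaleR_exp_l2_in_L2_on: "c *\<^sub>R exp_l2 T a \<in> L2_on T"
  using rep_scaleR_exp_l2[of c T a] unfolding L2_on_def mem_Collect_eq
  by eventually_elim simp

lemma inner_exp_l2:
  "inner (exp_l2 T a) f = (LINT s:{-T<..<0}|lborel. exp (a * s) * rep_l2 f s)"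
proof -
  have "(\<integral>s. rep_l2 (exp_l2 T a) s * rep_l2 f s \<partial>lborel) =
    (\<integral>s. indicator {-T<..<0} s * (exp (a * s) * rep_l2 f s) \<partial>lborel)"
    by (rule integral_cong_AE) (use rep_exp_l2[of T a] in \<open>auto elim: eventually_mono\<close>)
  then show ?thesis
    by (simp add: inner_l2_rep set_lebesgue_integral_def)
qed

text \<open>Integrating the derivative of \<open>u * \<phi>\<close> leaves only boundary terms, and
  \<open>\<phi>\<close> vanishes at both endpoints. This makes classical derivatives weak
  ones.\<close>

lemma test_function_integral_by_parts:
  assumes "T > 0" "test_function T \<phi>"
    and u: "\<And>s. (u has_real_derivative u' s) (at s)" "continuous_on UNIV u'"
  shows "(LINT s:{-T<..<0}|lborel. u s * deriv \<phi> s) = - (LINT s:{-T<..<0}|lborel. u' s * \<phi> s)"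
proof -
  have \<phi>: "(\<phi> has_real_derivative deriv \<phi> s) (at s)" for s
    using assms(2) by (simp add: test_function_def DERIV_deriv_iff_real_differentiable)
  have \<phi>': "continuous_on S (deriv \<phi>)" for S
    using assms(2) continuous_on_subset by (auto simp: test_function_def)
  have cu': "continuous_on S u'" for S
    using u(2) continuous_on_subset by blast
  have cu: "continuous_on S u" for S
    using u(1) DERIV_isCont continuous_at_imp_continuous_on by blast
  note c = \<phi>' cu' cu test_function_continuous[OF assms(2)]
  note [measurable] = borel_measurable_continuous_onI[OF c(1)] borel_measurable_continuous_onI[OF c(3)]
    borel_measurable_continuous_onI[OF c(2)] borel_measurable_continuous_onI[OF c(4)]
  have int: "set_integrable lborel {-T<..<0} f" if "continuous_on {-T..0} f" for f :: "real \<Rightarrow> real"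
    by (rule set_integrable_subset[OF borel_integrable_atLeastAtMost'[OF that]]) auto
  \<comment> \<open>The fundamental theorem of calculus is applied on the closed interval; the two
    endpoints have measure zero.\<close>
  have AE: "AE s in lborel. s \<noteq> -T \<and> s \<noteq> (0::real)"
    using AE_lborel_singleton[of "-T"] AE_lborel_singleton[of 0] by eventually_elim simp
  have "(LINT s:{-T<..<0}|lborel. u s * deriv \<phi> s + u' s * \<phi> s)
      = (\<integral>s. indicator {-T..0} s *\<^sub>R (u s * deriv \<phi> s + u' s * \<phi> s) \<partial>lborel)"
    unfolding set_lebesgue_integral_def
  proof (rule integral_cong_AE)
    show "AE s in lborel. indicat_real {-T<..<0} s *\<^sub>R (u s * deriv \<phi> s + u' s * \<phi> s) =
      indicat_real {-T..0} s *\<^sub>R (u s * deriv \<phi> s + u' s * \<phi> s)"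
      using AE by eventually_elim (auto simp: indicator_def)
  qed simp_all
  also have "\<dots> = u 0 * \<phi> 0 - u (-T) * \<phi> (-T)"
  proof (rule integral_FTC_Icc)
    fix s
    have "((\<lambda>s. u s * \<phi> s) has_real_derivative u s * deriv \<phi> s + u' s * \<phi> s) (at s)"
      using u(1)[of s] \<phi>[of s] by (auto intro!: derivative_eq_intros)
    then show "((\<lambda>s. u s * \<phi> s) has_vector_derivative u s * deriv \<phi> s + u' s * \<phi> s) (at s within {-T..0})"
      using has_real_derivative_iff_has_vector_derivative has_vector_derivative_at_within by blast
  qed (use assms c in \<open>auto intro!: continuous_intros\<close>)
  also have "\<dots> = 0"
    using test_function_eq_0[OF assms(2), of 0] test_function_eq_0[OF assms(2), of "-T"] by simp
  finally have "(LINT s:{-T<..<0}|lborel. u s * deriv \<phi> s + u' s * \<phi> s) = 0" .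
  moreover have "(LINT s:{-T<..<0}|lborel. u s * deriv \<phi> s + u' s * \<phi> s) =
    (LINT s:{-T<..<0}|lborel. u s * deriv \<phi> s) + (LINT s:{-T<..<0}|lborel. u' s * \<phi> s)"
    by (intro set_integral_add int continuous_intros c)
  ultimately show ?thesis
    by simp
qed

lemma set_lebesgue_integral_rep_scaleR_exp_l2:
  assumes [measurable]: "\<phi> \<in> borel_measurable borel"
  shows "(LINT s:{-T<..<0}|lborel. rep_l2 (c *\<^sub>R exp_l2 T a) s * \<phi> s) =
    (LINT s:{-T<..<0}|lborel. c * exp (a * s) * \<phi> s)"
  unfolding set_lebesgue_integral_def
  by (rule integral_cong_AE)
    (use rep_scaleR_exp_l2[of c T a] in \<open>auto elim: eventually_mono simp: indicator_def\<close>)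

lemma weak_derivative_scaleR_exp_l2:
  assumes "T > 0"
  shows "weak_derivative T (c *\<^sub>R exp_l2 T a) ((c * a) *\<^sub>R exp_l2 T a)"
  unfolding weak_derivative_def
proof (intro allI impI)
  fix \<phi> assume \<phi>: "test_function T \<phi>"
  have [measurable]: "\<phi> \<in> borel_measurable borel" "deriv \<phi> \<in> borel_measurable borel"
    using \<phi> test_function_continuous[OF \<phi>]
    by (auto simp: test_function_def intro: borel_measurable_continuous_onI)
  have "((\<lambda>s. c * exp (a * s)) has_real_derivative c * a * exp (a * s)) (at s)" for s
    by (auto intro!: derivative_eq_intros)
  then show "(LINT s:{-T<..<0}|lborel. rep_l2 (c *\<^sub>R exp_l2 T a) s * deriv \<phi> s) =
    - (LINT s:{-T<..<0}|lborel. rep_l2 ((c * a) *\<^sub>R exp_l2 T a) s * \<phi> s)"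
    by (auto simp: set_lebesgue_integral_rep_scaleR_exp_l2
      intro!: test_function_integral_by_parts[OF assms \<phi>] continuous_intros)
qed

lemma wderiv_scaleR_exp_l2: "T > 0 \<Longrightarrow> wderiv T (c *\<^sub>R exp_l2 T a) = (c * a) *\<^sub>R exp_l2 T a"
  by (intro wderiv_eqI scaleR_exp_l2_in_L2_on weak_derivative_scaleR_exp_l2)

lemma point_value_scaleR_exp_l2:
  assumes "T > 0" "s \<in> {-T..0}"
  shows "point_value T (c *\<^sub>R exp_l2 T a) s = c * exp (a * s)"
proof (rule point_value_eqI[where u = "\<lambda>s. c * exp (a * s)"])
  show "AE r in lborel. r \<in> {-T<..<0} \<longrightarrow> rep_l2 (c *\<^sub>R exp_l2 T a) r = c * exp (a * r)"
    using rep_scaleR_exp_l2[of c T a] by eventually_elim simp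
qed (use assms in \<open>auto intro!: continuous_intros\<close>)

lemma scaleR_exp_l2_in_W12: "T > 0 \<Longrightarrow> c *\<^sub>R exp_l2 T a \<in> W12 T"
  unfolding W12_def using scaleR_exp_l2_in_L2_on weak_derivative_scaleR_exp_l2 by blast


section \<open>The root \<open>\<xi>\<close> and the maximization over controls\<close>

text \<open>Existence: \<open>g\<close> vanishes at 0 with slope \<open>A * T - 1 > 0\<close>, so it
  is positive just to the right of 0, and it is negative from \<open>A\<close> on. Uniqueness: two
  positive roots together with the root 0 would give two zeros of the injective function
  \<open>g'\<close> by Rolle's theorem.\<close>

lemma xi_root:
  assumes "A > 0" "T > 0" "A * T > 1"
  shows "xi A T > 0 \<and> xi A T = A * (1 - exp (- xi A T * T))"
  unfolding xi_def
proof (rule theI')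
  define g where "g = (\<lambda>z. A * (1 - exp (- z * T)) - z)"
  define g' where "g' = (\<lambda>z. A * T * exp (- z * T) - 1)"
  have g: "(g has_real_derivative g' z) (at z)" for z
    unfolding g_def g'_def by (auto intro!: derivative_eq_intros)
  have cont: "continuous_on S g" for S
    unfolding g_def by (intro continuous_intros)
  have "\<exists>d>0. \<forall>h>0. h < d \<longrightarrow> g 0 < g (0 + h)"
    by (rule DERIV_pos_inc_right[OF g]) (use assms in \<open>simp add: g'_def\<close>)
  then obtain d where d: "d > 0" "\<And>h. 0 < h \<Longrightarrow> h < d \<Longrightarrow> g h > 0"
    by (auto simp: g_def)
  define h where "h = d / 2"
  have h: "h > 0" "g h > 0"
    using d by (auto simp: h_def)
  have neg: "g z < 0" if "z \<ge> A" for z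
  proof -
    have "A * exp (- z * T) > 0"
      using assms by simp
    then show ?thesis
      using that unfolding g_def right_diff_distrib by linarith
  qed
  have "h < A"
    using h(2) neg[of h] by linarith
  \<comment> \<open>Starting at \<open>h\<close> rather than at 0 excludes the trivial root
    0.\<close>
  then obtain z where z: "h \<le> z" "g z = 0"
    using IVT2'[of g A 0 h] h neg[of A] cont by force
  have less: False if xy: "0 < x" "x < y" "g x = 0" "g y = 0" for x y
  proof -
    have root: "\<exists>z. u < z \<and> z < v \<and> g' z = 0" if uv: "u < v" "g u = g v" for u v
    proof -
      obtain z where z: "u < z" "z < v" "(*) (g' z) = (\<lambda>w. 0)"
        using Rolle_deriv[OF uv cont g[unfolded has_field_derivative_def]] by blast
      \<comment> \<open>Rolle's theorem yields equality with the zero linear map; evaluation at 1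
        gives the number.\<close>
      have "g' z * 1 = 0"
        using z(3) by (rule fun_cong)
      then show ?thesis
        using z(1,2) by auto
    qed
    obtain r where r: "0 < r" "r < x" "g' r = 0"
      using root[of 0 x] xy by (auto simp: g_def)
    obtain s where s: "x < s" "s < y" "g' s = 0"
      using root[of x y] xy by auto
    have "A * T * exp (- r * T) = A * T * exp (- s * T)"
      using r(3) s(3) unfolding g'_def by linarith
    then have "r * T = s * T"
      using assms by simp
    then show False
      using r(2) s(1) \<open>T > 0\<close> by simp
  qed
  show "\<exists>!z. z > 0 \<and> z = A * (1 - exp (- z * T))"
  proof (rule ex1I)
    show "z > 0 \<and> z = A * (1 - exp (- z * T))"
      using z h by (simp add: g_def)
    fix y assume "y > 0 \<and> y = A * (1 - exp (- y * T))"
    then show "y = z"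
      using less[of y z] less[of z y] z h by (cases y z rule: linorder_cases) (auto simp: g_def)
  qed
qed

text \<open>A concave function lies below its tangent at \<open>c\<close>. Scaling by
  \<open>t = k / c\<close> reduces this to the tangent at 1. For \<open>a > 0\<close> that is
  Young's inequality; for \<open>a < 0\<close> it follows from the tangent bounds of
  \<open>exp\<close> and \<open>ln\<close>.\<close>

lemma powr_div_le_tangent:
  fixes a c k :: real
  assumes c: "c > 0" and a: "a < 1" "a \<noteq> 0" and k: "k > 0 \<or> k = 0 \<and> a > 0"
  shows "k powr a / a \<le> c powr a / a + c powr (a - 1) * (k - c)"
proof -
  define t where "t = k / c"
  have t: "t powr a / a \<le> 1 / a + t - 1"
  proof (cases "t = 0")
    case True
    then have "a > 0" using c k by (auto simp: t_def)
    \<comment> \<open>Since \<open>0 powr a = 0\<close>, the claim reads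
      \<open>1 \<le> 1 / a\<close>.\<close>
    then show ?thesis using True a by (simp add: field_simps)
  next
    case False
    then have "t > 0" using c k by (auto simp: t_def)
    show ?thesis
    proof (cases "a > 0")
      case True
      have "t powr a * 1 powr (1 - a) \<le> a * t + (1 - a) * 1"
        using True a \<open>t > 0\<close> by (intro Youngs_inequality_0) auto
      then show ?thesis
        using True by (simp add: field_simps)
    next
      case False
      have "1 + a * ln t \<le> t powr a"
        using \<open>t > 0\<close> exp_ge_add_one_self[of "a * ln t"] by (simp add: powr_def)
      moreover have "a * (t - 1) \<le> a * ln t"
        using False ln_le_minus_one[OF \<open>t > 0\<close>] by (intro mult_left_mono_neg) auto
      ultimately show ?thesis
        using False a by (simp add: field_simps)
    qed
  qed
  have "k = c * t" using c by (simp add: t_def)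
  moreover have "t \<ge> 0" using c k by (auto simp: t_def)
  ultimately have "k powr a / a = c powr a * (t powr a / a)"
    using c by (simp add: powr_mult)
  also have "\<dots> \<le> c powr a * (1 / a + t - 1)"
    using t by (intro mult_left_mono) auto
  also have "\<dots> = c powr a / a + c powr a * (t - 1)"
    by (simp add: algebra_simps)
  also have "c powr a * (t - 1) = c powr (a - 1) * (k - c)"
    using c \<open>k = c * t\<close> by (simp add: powr_diff field_simps)
  finally show ?thesis .
qed

text \<open>The slope of the utility at consumption \<open>c\<close> is
  \<open>c powr - \<sigma>\<close>, exactly the price of investment. So the tangent inequality at
  \<open>c\<close> bounds every choice by one constant, and the investment \<open>m - c\<close>
  attains it.\<close>

lemma SUP_utility:
  assumes "\<sigma> > 0" "\<sigma> \<noteq> 1" "c > 0" "c \<le> m"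
  shows "(SUP i\<in>{0..m}. utility \<sigma> (m - i) + ereal (i * c powr - \<sigma>)) =
    ereal (\<sigma> / (1 - \<sigma>) * (c * c powr - \<sigma>) + m * c powr - \<sigma>)"
proof (rule antisym)
  define q where "q = c powr - \<sigma>"
  have c: "c powr (1 - \<sigma>) = c * q"
    using \<open>c > 0\<close> by (simp add: q_def powr_diff powr_minus field_simps)
  have eq: "c powr (1 - \<sigma>) / (1 - \<sigma>) + (m - c) * q = \<sigma> / (1 - \<sigma>) * (c * q) + m * q"
    using \<open>\<sigma> \<noteq> 1\<close> by (simp add: c field_simps)
  have "utility \<sigma> (m - i) + ereal (i * q) \<le> ereal (\<sigma> / (1 - \<sigma>) * (c * q) + m * q)"
    if i: "i \<in> {0..m}" for i
  proof (cases "m - i = 0 \<and> \<sigma> > 1")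
    case True
    \<comment> \<open>Here the utility is \<open>-\<infinity>\<close>, so the bound is
      trivial.\<close>
    then show ?thesis by (simp add: utility_def)
  next
    case False
    have "(m - i) powr (1 - \<sigma>) / (1 - \<sigma>) \<le> c powr (1 - \<sigma>) / (1 - \<sigma>) + q * (m - i - c)"
    proof -
      have "m - i > 0 \<or> m - i = 0 \<and> 1 - \<sigma> > 0"
        using i False \<open>\<sigma> \<noteq> 1\<close> by auto
      then show ?thesis
        using powr_div_le_tangent[of c "1 - \<sigma>" "m - i"] assms by (simp add: q_def)
    qed
    then have "(m - i) powr (1 - \<sigma>) / (1 - \<sigma>) + i * q \<le> \<sigma> / (1 - \<sigma>) * (c * q) + m * q"
      using eq by (simp add: algebra_simps)
    then show ?thesis
      using False by (auto simp: utility_def)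
  qed
  then show "(SUP i\<in>{0..m}. utility \<sigma> (m - i) + ereal (i * c powr - \<sigma>)) \<le>
    ereal (\<sigma> / (1 - \<sigma>) * (c * c powr - \<sigma>) + m * c powr - \<sigma>)"
    by (intro SUP_least) (simp add: q_def)
  have "utility \<sigma> (m - (m - c)) + ereal ((m - c) * q) = ereal (\<sigma> / (1 - \<sigma>) * (c * q) + m * q)"
    using eq \<open>c > 0\<close> by (simp add: utility_def)
  then show "ereal (\<sigma> / (1 - \<sigma>) * (c * c powr - \<sigma>) + m * c powr - \<sigma>) \<le>
    (SUP i\<in>{0..m}. utility \<sigma> (m - i) + ereal (i * c powr - \<sigma>))"
    using assms unfolding q_def by (intro SUP_upper2[of "m - c"]) auto
qed

section \<open>The operators on multiples of the exponential vector\<close>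

lemma op_A_scaleR_exp_l2:
  "T > 0 \<Longrightarrow> op_A T (c *\<^sub>R (1, exp_l2 T a)) = c *\<^sub>R (0, a *\<^sub>R exp_l2 T a)"
  by (simp add: op_A_def wderiv_scaleR_exp_l2)

lemma scaleR_exp_l2_in_dom_A: "T > 0 \<Longrightarrow> c *\<^sub>R (1, exp_l2 T a) \<in> dom_A T"
  by (simp add: dom_A_def scaleR_exp_l2_in_W12 point_value_scaleR_exp_l2)

lemma op_B_scaleR_exp_l2:
  "T > 0 \<Longrightarrow> op_B T (c *\<^sub>R (1, exp_l2 T a)) = c * (1 - exp (- a * T))"
  by (simp add: op_B_def point_value_scaleR_exp_l2 right_diff_distrib)

text \<open>Homogeneity along the line of possible gradients, where \<open>op_A\<close> is explicit;
  it reduces continuity of the gradient in the graph norm to continuity of a scalar factor.\<close>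

lemma graph_norm_scaleR_exp_l2:
  assumes "T > 0"
  shows "graph_norm T (c *\<^sub>R (1, exp_l2 T a)) = \<bar>c\<bar> * graph_norm T (1, exp_l2 T a)"
proof -
  have "op_A T (1, exp_l2 T a) = (0, a *\<^sub>R exp_l2 T a)"
    using op_A_scaleR_exp_l2[OF assms, of 1 a] by simp
  then show ?thesis
    by (simp only: graph_norm_def op_A_scaleR_exp_l2[OF assms] norm_scaleR power_mult_distrib
        distrib_left[symmetric] real_sqrt_mult real_sqrt_abs abs_abs)
qed

lemma Gamma0_eq_inner: "Gamma0 A T x = inner (1, exp_l2 T (xi A T)) x"
  by (cases x) (simp add: Gamma0_def inner_exp_l2)

theorem proposition5p9:
  fixes A T \<rho> \<sigma> :: real
  assumes "A > 0" and "T > 0" and "\<rho> > 0" and "\<sigma> > 0" and "\<sigma> \<noteq> 1"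
    and "A * T > 1"
    and "\<rho> > xi A T * (1 - \<sigma>)"
  shows "classical_solution A T \<rho> \<sigma> (domain_O A T \<rho> \<sigma>) (value_v A T \<rho> \<sigma>)"
proof -
  define z where "z = xi A T"
  define n where "n = nu A T \<rho> \<sigma>"
  define e where "e = (1::real, exp_l2 T z)"
  define G where "G = (\<lambda>x. inner e x)"
  define p where "p = (\<lambda>x. n * G x powr - \<sigma>)"
  define M where "M = (\<rho> - z * (1 - \<sigma>)) / \<sigma>"
  define U where "U = domain_O A T \<rho> \<sigma>"
  have z: "z > 0" "1 - exp (- z * T) = z / A"
    using xi_root[of A T] assms by (simp_all add: z_def field_simps)
  have "M > 0"
    using assms by (simp add: M_def z_def)
  have n: "n = M powr - \<sigma> * (A / z) powr (1 - \<sigma>)"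
    by (simp add: n_def nu_def M_def z_def)
  have "A / z > 0"
    using z assms by simp
  then have "n > 0"
    using \<open>M > 0\<close> z assms unfolding n by (intro mult_pos_pos) simp_all
  \<comment> \<open>The exponent of \<open>M\<close> becomes
    \<open>- \<sigma> * (- 1 / \<sigma>) = 1\<close>, that of \<open>A / z\<close> becomes
    \<open>- (1 - \<sigma>) / \<sigma> + 1 / \<sigma> = 1\<close>.\<close>
  have n_root: "n powr (- 1 / \<sigma>) * (A / z) powr (1 / \<sigma>) = M * (A / z)"
  proof -
    have "n powr (- 1 / \<sigma>) * (A / z) powr (1 / \<sigma>) = 
      M powr (- \<sigma> * (- 1 / \<sigma>)) * ((A / z) powr ((1 - \<sigma>) * (- 1 / \<sigma>)) * (A / z) powr (1 / \<sigma>))"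
      using \<open>M > 0\<close> \<open>A / z > 0\<close> unfolding n by (simp only: powr_mult powr_powr mult.assoc)
    also have "\<dots> = M powr 1 * (A / z) powr 1"
      unfolding powr_add[symmetric] using \<open>\<sigma> > 0\<close> by (simp add: field_simps)
    finally show ?thesis
      using \<open>M > 0\<close> \<open>A > 0\<close> z by simp
  qed
  have Gamma0: "Gamma0 A T x = G x" for x
    by (simp add: Gamma0_eq_inner G_def e_def z_def)
  have contG: "continuous_on S G" for S
    unfolding G_def by (intro continuous_intros)
  have U: "U = {x \<in> state_space T. G x > 0 \<and> A * fst x > M * (A / z) * G x}"
    unfolding U_def domain_O_def Gamma0 n_def[symmetric] z_def[symmetric] n_root ..
  have v: "value_v A T \<rho> \<sigma> = (\<lambda>x. n * (G x powr (1 - \<sigma>) / (1 - \<sigma>)))"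
    by (simp add: value_v_def Gamma0 n_def fun_eq_iff)

  \<comment> \<open>Openness of the domain and regularity of the gradient\<close>
  have "open ({x. 0 < G x} \<inter> {x. M * (A / z) * G x < A * fst x})"
    by (intro open_Int open_Collect_less continuous_intros contG)
  then have openU: "openin (top_of_set (state_space T)) U"
    by (auto simp: U openin_open intro!: exI[of _ "{x. 0 < G x} \<inter> {x. M * (A / z) * G x < A * fst x}"])
  have state: "p x *\<^sub>R e \<in> state_space T" for x
    by (simp add: e_def state_space_def scaleR_exp_l2_in_L2_on)
  have deriv: "(value_v A T \<rho> \<sigma> has_derivative (\<lambda>h. inner (p x *\<^sub>R e) h)) (at x within U)"
    if "x \<in> U" for x
  proof -
    have "((\<lambda>t. n * (t powr (1 - \<sigma>) / (1 - \<sigma>))) has_real_derivative p x) (at (G x))"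
      using that \<open>\<sigma> \<noteq> 1\<close> unfolding p_def U
      by (auto intro!: derivative_eq_intros has_real_derivative_powr)
    moreover have "(G has_derivative G) (at x within U)"
      unfolding G_def by (intro bounded_linear_imp_has_derivative bounded_linear_inner_right)
    ultimately show ?thesis
      unfolding v by (auto dest: DERIV_compose_FDERIV simp: G_def mult.commute)
  qed
  have contp: "continuous_on U p"
    unfolding p_def U by (intro continuous_intros contG) auto
  then have cont: "continuous_on U (\<lambda>x. p x *\<^sub>R e)"
    by (intro continuous_intros)
  have dom: "p x *\<^sub>R e \<in> dom_A T" for x
    using scaleR_exp_l2_in_dom_A \<open>T > 0\<close> by (simp only: e_def)
  have graph: "((\<lambda>y. graph_norm T (p y *\<^sub>R e - p x *\<^sub>R e)) \<longlongrightarrow> 0) (at x within U)" if "x \<in> U" for x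
  proof -
    \<comment> \<open>All gradients are multiples of the fixed vector \<open>e\<close>, and so are
      their differences.\<close>
    have "graph_norm T (p y *\<^sub>R e - p x *\<^sub>R e) = \<bar>p y - p x\<bar> * graph_norm T e" for y
      unfolding e_def scaleR_diff_left[symmetric] by (rule graph_norm_scaleR_exp_l2[OF \<open>T > 0\<close>])
    moreover have "((\<lambda>y. \<bar>p y - p x\<bar> * graph_norm T e) \<longlongrightarrow> \<bar>p x - p x\<bar> * graph_norm T e) (at x within U)"
      using contp that by (intro tendsto_intros) (simp add: continuous_on_def)
    ultimately show ?thesis
      by simp
  qed

  \<comment> \<open>The HJB equation at a point of the domain\<close>
  have hjb: "ereal (\<rho> * value_v A T \<rho> \<sigma> x) = ereal (inner (op_A T (p x *\<^sub>R e)) x) +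
      (SUP i\<in>{0..A * fst x}. utility \<sigma> (A * fst x - i) + ereal (i * op_B T (p x *\<^sub>R e)))"
    if "x \<in> U" for x
  proof -
    define c where "c = M * (A / z) * G x"
    have G: "G x > 0" "c < A * fst x"
      using that by (auto simp: U c_def)
    have c: "c > 0"
      using G \<open>M > 0\<close> \<open>A / z > 0\<close> unfolding c_def by (intro mult_pos_pos)
    \<comment> \<open>Splitting off one factor \<open>A / z\<close> lets the remaining powers in
      \<open>n * G x powr - \<sigma>\<close> combine to \<open>c powr - \<sigma>\<close>. Thus the
      marginal utility at \<open>c\<close> is \<open>p x * z / A\<close>, which is the value of
      \<open>op_B\<close> at the gradient.\<close>
    have "(A / z) powr (1 - \<sigma>) = (A / z) powr - \<sigma> * (A / z)"
      using powr_add[of "A / z" "- \<sigma>" 1] \<open>A > 0\<close> z by simp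
    then have "n * G x powr - \<sigma> = c powr - \<sigma> * (A / z)"
      unfolding c_def n powr_mult by (simp only: mult_ac)
    then have q: "c powr - \<sigma> = p x * z / A"
      using z \<open>A > 0\<close> by (simp add: p_def field_simps)
    have cq: "c * c powr - \<sigma> = M * G x * p x"
    proof -
      have "c * (p x * z / A) = M * G x * p x"
        using z \<open>A > 0\<close> by (simp add: c_def)
      then show ?thesis
        by (simp only: q)
    qed
    have Aq: "A * fst x * c powr - \<sigma> = fst x * (p x * z)"
      unfolding q using \<open>A > 0\<close> by simp
    have "inner (op_A T (p x *\<^sub>R e)) x = p x * z * inner (exp_l2 T z) (snd x)"
      unfolding e_def op_A_scaleR_exp_l2[OF \<open>T > 0\<close>] by (cases x) simp
    also have "inner (exp_l2 T z) (snd x) = G x - fst x"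
      by (cases x) (simp add: G_def e_def)
    finally have a: "inner (op_A T (p x *\<^sub>R e)) x = p x * z * (G x - fst x)" .
    have b: "op_B T (p x *\<^sub>R e) = c powr - \<sigma>"
      unfolding e_def op_B_scaleR_exp_l2[OF \<open>T > 0\<close>] z(2) q by simp
    have "G x powr (1 - \<sigma>) = G x * G x powr - \<sigma>"
      using G by (simp add: powr_diff powr_minus field_simps)
    then have "\<rho> * value_v A T \<rho> \<sigma> x = \<rho> * (p x * G x) / (1 - \<sigma>)"
      by (simp add: v p_def)
    also have "\<rho> * (p x * G x) / (1 - \<sigma>) =
      p x * z * (G x - fst x) + (\<sigma> / (1 - \<sigma>) * (c * c powr - \<sigma>) + A * fst x * c powr - \<sigma>)"
    proof -
      \<comment> \<open>The terms with \<open>fst x\<close> cancel, as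
        \<open>A * fst x * c powr - \<sigma>\<close> equals \<open>p x * z * fst x\<close>. What is
        left is \<open>\<rho> = \<sigma> * M + z * d\<close>, the definition of \<open>M\<close>
        solved for \<open>\<rho>\<close>, times \<open>p x * G x / d\<close>.\<close>
      define d where "d = 1 - \<sigma>"
      have "d \<noteq> 0" "\<rho> = \<sigma> * M + z * d"
        using \<open>\<sigma> > 0\<close> \<open>\<sigma> \<noteq> 1\<close> by (simp_all add: d_def M_def)
      then show ?thesis
        unfolding cq Aq d_def[symmetric] by (simp add: field_simps)
    qed
    finally show ?thesis
      unfolding a b SUP_utility[OF \<open>\<sigma> > 0\<close> \<open>\<sigma> \<noteq> 1\<close> c less_imp_le[OF G(2)]] by simp
  qed
  show ?thesis
    unfolding classical_solution_def U_def[symmetric]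
    by (intro conjI exI[of _ "\<lambda>x. p x *\<^sub>R e"] ballI openU state deriv cont dom graph hjb)
qed

end
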